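(* Consider the random scalar conservation law $$\partial_t u(t,x,\xi)+\partial_x\big(u^2(t,x,\xi)+|u(t,x,\xi)|\big)=0\qquad\text{with initial values}\qquad u_0(x,\xi)=\operatorname{sign}\big(x-(\xi-\tfrac12)\big),\quad \xi\sim\mathcal{U}(0,1).$$ Haar-type stochastic Galerkin formulations (see context) to this conservation law read as $$\partial_t\hat u+\partial_x\big(\hat u^{\ast2}+\hat u\ast\hat s(\hat u)\big)=\vec 0\qquad\text{with initial values}\qquad \hat u_k(0,x)=\langle u_0(x,\xi),\phi_k(\xi)\rangle_{\mathbb{P}}$$ and, for the flux function $\hat f(\hat u)=\hat u^{\ast2}+\hat u\ast\hat s(\hat u)$, generalized Jacobian $$\mathrm{D}_{\hat u}\hat f(\hat u)=2\mathcal{P}(\hat u)+\mathcal{P}(\hat s(\hat u))=\mathcal{H}\Big[2\mathcal{D}(\hat u)+\operatorname{sign}\{\mathcal{D}(\hat u)\}\Big]\mathcal{H}^{T}.$$ It is defined for all states $\hat u\in\mathbb{R}^{K+1}$.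
   Context: Haar-type expansion. Let $K\in\mathbb{N}_0$ and let $\xi\sim\mathcal{U}(0,1)$ be uniformly distributed, with law $\mathbb{P}$; write $\langle f,g\rangle_{\mathbb{P}}=\mathbb{E}[f(\xi)g(\xi)]$. Matrix and vector indices run over $0,\dots,K$. The canonical Haar matrix $A_c\in\mathbb{R}^{(K+1)\times(K+1)}$ has all entries equal to $1$ in row $0$; for $i=1,\dots,K$, row $i$ has zeros in columns $0,\dots,i-2$, the entry $h^d_i=s_ih^r_i$ in column $i-1$, and the entry $h^r_i=\sqrt{(K+1)/(s_i^2-s_i)}$ in columns $i,\dots,K$, where $s_i=-(K+1-i)$. A Haar-type matrix is $A=\begin{pmatrix}1&0\\0&O\end{pmatrix}A_c$ with an orthogonal matrix $O\in\mathbb{R}^{K\times K}$; it satisfies $AA^T=(K+1)I$. Its basis functions are $\phi_k(\xi)=\sum_{\ell=0}^K A_{k\ell}\,\chi_{[0,1]}((K+1)\xi-\ell)$, $k=0,\dots,K$, where $\chi_{[0,1]}$ is the indicator function of $[0,1]$; they are orthonormal in $L^2(\mathbb{P})$. Put $\mathcal{H}:=A/\sqrt{K+1}$, an orthogonal matrix. The unknown $\hat u(t,x)\in\mathbb{R}^{K+1}$ collects the gPC modes, i.e. the coefficients of the truncated expansion $\sum_{k=0}^K\hat u_k(t,x)\phi_k(\xi)$ that approximates $u(t,x,\xi)$. The stochastic Galerkin matrix is $\mathcal{P}(\hat u)=\sum_{k=0}^K\hat u_k\mathcal{M}_k$ with $\mathcal{M}_k=(\langle\phi_k,\phi_i\phi_j\rangle_{\mathbb{P}})_{i,j=0,\dots,K}$,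 the Galerkin product (representing products of random quantities) is $\hat u\ast\hat q=\mathcal{P}(\hat u)\hat q$, and $\hat u^{\ast 2}=\hat u\ast\hat u$; $\hat e_1=(1,0,\dots,0)^T\in\mathbb{R}^{K+1}$. For Haar-type expansions $\mathcal{P}(\hat u)=\mathcal{H}\mathcal{D}(\hat u)\mathcal{H}^T$ with $\mathcal{D}(\hat u)$ a diagonal matrix of eigenvalues. Signs of diagonal matrices are taken entrywise on the diagonal. The gPC modes of the sign are $\hat s(\hat u):=\mathcal{H}\,\operatorname{sign}\{\mathcal{D}(\hat u)\}\,\mathcal{H}^T\hat e_1$, and those of the absolute value are $\hat s(\hat u)\ast\hat u$. $\mathrm{D}_{\hat u}$ denotes the Jacobian with respect to $\hat u$; derivatives of the non-smooth absolute value are understood as generalized gradients. *)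

theory Defs
  imports "HOL-Probability.Probability"
begin

type_synonym 'n rvec = "(real, 'n) vec"
type_synonym 'n rmat = "((real, 'n) vec, 'n) vec"

text \<open>
  The index set \<open>{0,\<dots>,K}\<close> is an arbitrary finite linearly ordered type \<open>'n\<close> with
  \<open>CARD('n) = K + 1\<close>; \<open>idx i\<close> is the number of the index \<open>i\<close>, counted from \<open>0\<close>.
\<close>

definition idx :: "'n::{finite,linorder} \<Rightarrow> nat" where
  "idx i = card {j. j < i}"

section \<open>Haar-type expansions\<close>

text \<open>Here \<open>s = -(K + 1 - i)\<close>.\<close>

definition haar_s :: "'n::{finite,linorder} \<Rightarrow> real" where
  "haar_s i = - (real CARD('n) - real (idx i))"

definition haar_hr :: "'n::{finite,linorder} \<Rightarrow> real" where
  "haar_hr i = sqrt (real CARD('n) / ((haar_s i)\<^sup>2 - haar_s i))"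

definition haar_hd :: "'n::{finite,linorder} \<Rightarrow> real" where
  "haar_hd i = haar_s i * haar_hr i"

definition canonical_haar :: "'n::{finite,linorder} rmat" where
  "canonical_haar = (\<chi> i j.
     if idx i = 0 then 1
     else if idx j + 1 < idx i then 0
     else if idx j + 1 = idx i then haar_hd i
     else haar_hr i)"

text \<open>
  The \<open>K \<times> K\<close> matrix \<open>Om\<close> has indices \<open>1,\<dots>,K\<close>. It is not given a type-indexed dimension
  because it is the empty matrix for \<open>K = 0\<close>.
\<close>

definition orthogonal_upto :: "nat \<Rightarrow> (nat \<Rightarrow> nat \<Rightarrow> real) \<Rightarrow> bool" where
  "orthogonal_upto K Om \<longleftrightarrow>
     (\<forall>i\<in>{1..K}. \<forall>j\<in>{1..K}.
        (\<Sum>k=1..K. Om i k * Om j k) = (if i = j then 1 else 0) \<and>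
        (\<Sum>k=1..K. Om k i * Om k j) = (if i = j then 1 else 0))"

definition block_one :: "(nat \<Rightarrow> nat \<Rightarrow> real) \<Rightarrow> 'n::{finite,linorder} rmat" where
  "block_one Om = (\<chi> i j.
     if idx i = 0 \<and> idx j = 0 then 1
     else if idx i = 0 \<or> idx j = 0 then 0
     else Om (idx i) (idx j))"

definition haar_type :: "'n::{finite,linorder} rmat \<Rightarrow> bool" where
  "haar_type A \<longleftrightarrow>
     (\<exists>Om. orthogonal_upto (CARD('n) - 1) Om \<and> A = block_one Om ** canonical_haar)"

definition law_xi :: "real measure" where
  "law_xi = uniform_measure lborel {0<..<1}"

definition inner_P :: "(real \<Rightarrow> real) \<Rightarrow> (real \<Rightarrow> real) \<Rightarrow> real" where
  "inner_P f g = (\<integral>\<xi>. f \<xi> * g \<xi> \<partial>law_xi)"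

definition haar_basis :: "'n::{finite,linorder} rmat \<Rightarrow> 'n \<Rightarrow> real \<Rightarrow> real" where
  "haar_basis A k \<xi> =
     (\<Sum>l\<in>UNIV. A $ k $ l * indicator {0..1} (real CARD('n) * \<xi> - real (idx l)))"

definition expansion :: "'n::{finite,linorder} rmat \<Rightarrow> 'n rvec \<Rightarrow> real \<Rightarrow> real" where
  "expansion A u \<xi> = (\<Sum>k\<in>UNIV. u $ k * haar_basis A k \<xi>)"

definition modes :: "'n::{finite,linorder} rmat \<Rightarrow> (real \<Rightarrow> real) \<Rightarrow> 'n rvec" where
  "modes A g = (\<chi> k. inner_P g (haar_basis A k))"

section \<open>Galerkin product and gPC modes of sign and absolute value\<close>

definition haar_H :: "'n::{finite,linorder} rmat \<Rightarrow> 'n rmat" where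
  "haar_H A = (1 / sqrt (real CARD('n))) *\<^sub>R A"

definition galerkin_M :: "'n::{finite,linorder} rmat \<Rightarrow> 'n \<Rightarrow> 'n rmat" where
  "galerkin_M A k = (\<chi> i j.
     inner_P (haar_basis A k) (\<lambda>\<xi>. haar_basis A i \<xi> * haar_basis A j \<xi>))"

definition galerkin_P :: "'n::{finite,linorder} rmat \<Rightarrow> 'n rvec \<Rightarrow> 'n rmat" where
  "galerkin_P A u = (\<Sum>k\<in>UNIV. u $ k *\<^sub>R galerkin_M A k)"

definition galerkin_prod ::
  "'n::{finite,linorder} rmat \<Rightarrow> 'n rvec \<Rightarrow> 'n rvec \<Rightarrow> 'n rvec" where
  "galerkin_prod A u q = galerkin_P A u *v q"

text \<open>
  As \<open>haar_H A\<close> is orthogonal, this is the only matrix \<open>D\<close> with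
  \<open>galerkin_P A u = haar_H A ** D ** transpose (haar_H A)\<close>.
\<close>

definition galerkin_D :: "'n::{finite,linorder} rmat \<Rightarrow> 'n rvec \<Rightarrow> 'n rmat" where
  "galerkin_D A u = transpose (haar_H A) ** galerkin_P A u ** haar_H A"

definition diagonal_matrix :: "'n::finite rmat \<Rightarrow> bool" where
  "diagonal_matrix D \<longleftrightarrow> (\<forall>i j. i \<noteq> j \<longrightarrow> D $ i $ j = 0)"

definition diag_mat :: "'n::finite rvec \<Rightarrow> 'n rmat" where
  "diag_mat d = (\<chi> i j. if i = j then d $ i else 0)"

definition sign_diag :: "'n::finite rmat \<Rightarrow> 'n rmat" where
  "sign_diag D = diag_mat (\<chi> i. sgn (D $ i $ i))"

definition e1 :: "'n::{finite,linorder} rvec" where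
  "e1 = (\<chi> i. if idx i = 0 then 1 else 0)"

definition sign_modes :: "'n::{finite,linorder} rmat \<Rightarrow> 'n rvec \<Rightarrow> 'n rvec" where
  "sign_modes A u =
     (haar_H A ** sign_diag (galerkin_D A u) ** transpose (haar_H A)) *v e1"

section \<open>Generalized gradients\<close>

text \<open>
  Generalized Jacobian and generalized gradient in the sense of Clarke: the convex hull of the
  limits of derivatives at points of differentiability that converge to the given point.
\<close>

definition generalized_jacobian ::
  "('n::finite rvec \<Rightarrow> 'n rvec) \<Rightarrow> 'n rvec \<Rightarrow> ('n rmat) set" where
  "generalized_jacobian f u = convex hull
     {J. \<exists>v Jv. v \<longlonglongrightarrow> u \<and>
           (\<forall>m::nat. (f has_derivative (\<lambda>h. Jv m *v h)) (at (v m))) \<and>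
           Jv \<longlonglongrightarrow> J}"

definition generalized_gradient :: "(real \<Rightarrow> real) \<Rightarrow> real \<Rightarrow> real set" where
  "generalized_gradient f x = convex hull
     {c. \<exists>v dv. v \<longlonglongrightarrow> x \<and>
           (\<forall>m::nat. (f has_real_derivative dv m) (at (v m))) \<and>
           dv \<longlonglongrightarrow> c}"

section \<open>Conservation laws\<close>

text \<open>
  Both predicates express \<open>\<partial>\<^sub>t q + \<partial>\<^sub>x g = 0\<close> on \<open>t > 0\<close>, \<open>x \<in> \<real>\<close>, with \<open>q 0 x = q0 x\<close>, for a
  conserved quantity \<open>q\<close> and a flux \<open>g\<close>, both given as functions of \<open>t\<close> and \<open>x\<close>.
\<close>

definition classical_conservation ::
  "(real \<Rightarrow> real \<Rightarrow> 'a::euclidean_space) \<Rightarrow> (real \<Rightarrow> real \<Rightarrow> 'a) \<Rightarrow> (real \<Rightarrow> 'a) \<Rightarrow> bool" where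
  "classical_conservation q g q0 \<longleftrightarrow>
     (\<forall>x. q 0 x = q0 x) \<and>
     continuous_on ({0..} \<times> UNIV) (\<lambda>(t, x). q t x) \<and>
     (\<forall>t>0. \<forall>x. \<exists>qt gx.
        ((\<lambda>s. q s x) has_vector_derivative qt) (at t) \<and>
        ((\<lambda>y. g t y) has_vector_derivative gx) (at x) \<and>
        qt + gx = 0)"

text \<open>Continuously differentiable test functions with compact support, and their partial derivatives.\<close>

definition test_function ::
  "(real \<Rightarrow> real \<Rightarrow> real) \<Rightarrow> (real \<Rightarrow> real \<Rightarrow> real) \<Rightarrow> (real \<Rightarrow> real \<Rightarrow> real) \<Rightarrow> bool" where
  "test_function \<psi> \<psi>t \<psi>x \<longleftrightarrow>
     (\<forall>t x. ((\<lambda>s. \<psi> s x) has_real_derivative \<psi>t t x) (at t)) \<and>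
     (\<forall>t x. ((\<lambda>y. \<psi> t y) has_real_derivative \<psi>x t x) (at x)) \<and>
     continuous_on UNIV (\<lambda>(t, x). \<psi>t t x) \<and>
     continuous_on UNIV (\<lambda>(t, x). \<psi>x t x) \<and>
     (\<exists>R. \<forall>t x. R < \<bar>t\<bar> \<or> R < \<bar>x\<bar> \<longrightarrow> \<psi> t x = 0)"

definition weak_conservation ::
  "(real \<Rightarrow> real \<Rightarrow> 'a::euclidean_space) \<Rightarrow> (real \<Rightarrow> real \<Rightarrow> 'a) \<Rightarrow> (real \<Rightarrow> 'a) \<Rightarrow> bool" where
  "weak_conservation q g q0 \<longleftrightarrow>
     (\<forall>R. set_integrable lborel ({0..R} \<times> {-R..R}) (\<lambda>(t, x). q t x) \<and>
          set_integrable lborel ({0..R} \<times> {-R..R}) (\<lambda>(t, x). g t x) \<and>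
          set_integrable lborel {-R..R} q0) \<and>
     (\<forall>\<psi> \<psi>t \<psi>x. test_function \<psi> \<psi>t \<psi>x \<longrightarrow>
        set_lebesgue_integral lborel ({0..} \<times> UNIV)
          (\<lambda>(t, x). \<psi>t t x *\<^sub>R q t x + \<psi>x t x *\<^sub>R g t x)
        + (\<integral>x. \<psi> 0 x *\<^sub>R q0 x \<partial>lborel) = 0)"

text \<open>
  The stochastic Galerkin formulation of the scalar random problem
  \<open>\<partial>\<^sub>t u + \<partial>\<^sub>x F(u) = 0\<close>, \<open>u(0,x,\<xi>) = u0 x \<xi>\<close>: the truncated expansion is inserted and the result
  is projected onto the basis functions. The first argument is the notion of solution.
\<close>

definition galerkin_formulation ::
  "((real \<Rightarrow> real \<Rightarrow> 'n rvec) \<Rightarrow> (real \<Rightarrow> real \<Rightarrow> 'n rvec) \<Rightarrow> (real \<Rightarrow> 'n rvec) \<Rightarrow> bool) \<Rightarrow>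
   'n::{finite,linorder} rmat \<Rightarrow> (real \<Rightarrow> real) \<Rightarrow> (real \<Rightarrow> real \<Rightarrow> real) \<Rightarrow>
   (real \<Rightarrow> real \<Rightarrow> 'n rvec) \<Rightarrow> bool" where
  "galerkin_formulation conservation A F u0 u \<longleftrightarrow>
     conservation
       (\<lambda>t x. modes A (\<lambda>\<xi>. expansion A (u t x) \<xi>))
       (\<lambda>t x. modes A (\<lambda>\<xi>. F (expansion A (u t x) \<xi>)))
       (\<lambda>x. modes A (\<lambda>\<xi>. u0 x \<xi>))"

section \<open>The model problem\<close>

definition scalar_flux :: "real \<Rightarrow> real" where
  "scalar_flux u = u\<^sup>2 + \<bar>u\<bar>"

definition initial_u :: "real \<Rightarrow> real \<Rightarrow> real" where
  "initial_u x \<xi> = sgn (x - (\<xi> - 1/2))"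

definition sg_flux :: "'n::{finite,linorder} rmat \<Rightarrow> 'n rvec \<Rightarrow> 'n rvec" where
  "sg_flux A u = galerkin_prod A u u + galerkin_prod A u (sign_modes A u)"

end

(*
  A function sum_l p_l chi_[0,1]((K+1) xi - l) takes exactly one of the values p_l for almost every
  xi, so products and compositions of such functions act on the values p_l separately. As
  A A^T = (K+1) I, passing from the modes u to the values A^T u is invertible, and it turns the
  stochastic Galerkin flux into the scalar flux applied in each component. A componentwise map is
  differentiable exactly where all of its components are, so its set of limiting derivatives is a
  product, and taking the convex hull commutes with products.
*)
theory Submission
  imports Defs
begin

section \<open>Generalized Jacobians of componentwise maps\<close>

text \<open>At a state with a vanishing eigenvalue the flux is not differentiable, and the value
  \<open>sgn 0 = 0\<close> in the formula for the Jacobian is not a limit of derivatives but only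
  the midpoint of the limits -1 and 1. Several eigenvalues can vanish at once, so membership needs
  the hull of a product, and for this the whole generalized Jacobian is computed. Chain and sum
  rules for generalized gradients are in general only inclusions; here they are equalities because
  the change of variables is invertible and the square is continuously differentiable. The flux is
  not homogeneous, so the variables must be the cell values \<open>transpose A *v u\<close>
  themselves and not their rescaling by \<open>transpose (haar_H A)\<close>. Hence the inverse pair
  \<open>(1 / real CARD('n)) *\<^sub>R A\<close>, \<open>transpose A\<close>; conjugation by it
  agrees with conjugation by the orthogonal matrix \<open>haar_H A\<close>.\<close>

lemma diag_mat_vector_mult: "diag_mat d *v x = (\<chi> i. d $ i * x $ i)"
  by (simp add: diag_mat_def matrix_vector_mult_def vec_eq_iff if_distrib if_distribR cong: if_cong)

lemma matrix_add_rdistrib: "(A + B) ** C = A ** C + B ** (C :: 'a::semiring_1 ^ 'n ^ 'm)"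
  by (simp add: matrix_matrix_mult_def vec_eq_iff sum.distrib distrib_right)

text \<open>Linearity in the diagonal is used twice: for the continuity that limits of derivatives
  require, and for moving the convex hull onto the diagonals.\<close>

lemma linear_diag_mat_conjugate: "linear (\<lambda>a::'n::finite rvec. R ** diag_mat a ** S)"
proof (rule linearI)
  have "diag_mat (a + b) = diag_mat a + diag_mat b" for a b :: "'n rvec"
    by (simp add: diag_mat_def vec_eq_iff)
  then show "R ** diag_mat (a + b) ** S = R ** diag_mat a ** S + R ** diag_mat b ** S" for a b
    by (simp add: matrix_add_ldistrib matrix_add_rdistrib)
  have "diag_mat (c *\<^sub>R a) = c *\<^sub>R diag_mat a" for c and a :: "'n rvec"
    by (simp add: diag_mat_def vec_eq_iff)
  then show "R ** diag_mat (c *\<^sub>R a) ** S = c *\<^sub>R (R ** diag_mat a ** S)" for c a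
    by (simp add: scalar_matrix_assoc matrix_scalar_ac)
qed

lemma has_derivative_vec_componentwise:
  fixes f :: "'a::real_normed_vector \<Rightarrow> (real, 'n::finite) vec"
  shows "(f has_derivative f') (at x) \<longleftrightarrow> (\<forall>i. ((\<lambda>y. f y $ i) has_derivative (\<lambda>h. f' h $ i)) (at x))"
  by (simp add: has_derivative_componentwise_within[of f] Basis_vec_def inner_axis)

lemma has_derivative_componentwise_map:
  fixes g :: "real \<Rightarrow> real" and a :: "'n::finite rvec"
  assumes "\<And>l. (g has_real_derivative a $ l) (at (w $ l))"
  shows "((\<lambda>x. \<chi> l. g (x $ l)) has_derivative (*v) (diag_mat a)) (at w)"
  unfolding has_derivative_vec_componentwise
proof
  fix l
  have "((\<lambda>x. g (x $ l)) has_derivative (\<lambda>h. h $ l * a $ l)) (at w)"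
    by (rule has_derivative_compose[OF bounded_linear_imp_has_derivative[OF bounded_linear_vec_nth]])
      (use assms[of l] in \<open>simp add: has_field_derivative_def mult.commute[of _ "a $ l"]\<close>)
  then show "((\<lambda>y. (\<chi> l. g (y $ l)) $ l) has_derivative (\<lambda>h. (diag_mat a *v h) $ l)) (at w)"
    by (simp add: diag_mat_vector_mult mult.commute)
qed

text \<open>\<open>J\<close> is arbitrary here. Restriction to coordinate lines makes each component
  differentiable, and uniqueness of derivatives then forces the off-diagonal entries to
  vanish.\<close>

lemma has_derivative_componentwise_map_iff:
  fixes g :: "real \<Rightarrow> real" and J :: "'n::finite rmat"
  shows "((\<lambda>x. \<chi> l. g (x $ l)) has_derivative (*v) J) (at w) \<longleftrightarrow>
    (\<exists>a. (\<forall>l. (g has_real_derivative a $ l) (at (w $ l))) \<and> J = diag_mat a)"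
proof
  assume *: "((\<lambda>x. \<chi> l. g (x $ l)) has_derivative (*v) J) (at w)"
  define a where "a = (\<chi> l. J $ l $ l)"
  have 1: "(g has_real_derivative a $ l) (at (w $ l))" for l
  proof -
    \<comment> \<open>The line through \<open>w\<close> along axis \<open>l\<close>, parametrised by
      its \<open>l\<close>-th coordinate, so that composing with it gives back \<open>g\<close>
      itself.\<close>
    have p: "((\<lambda>t. w + (t - w $ l) *\<^sub>R axis l 1) has_derivative (\<lambda>t. t *\<^sub>R axis l 1)) (at (w $ l))"
      by (auto intro!: derivative_eq_intros)
    have "((\<lambda>x. g (x $ l)) has_derivative (\<lambda>h. (J *v h) $ l)) (at w)"
      using * by (simp add: has_derivative_vec_componentwise)
    then have "((\<lambda>x. g (x $ l)) has_derivative (\<lambda>h. (J *v h) $ l))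
        (at (w + (w $ l - w $ l) *\<^sub>R axis l 1))"
      by simp
    from has_derivative_compose[OF p this]
    have "(g has_derivative (\<lambda>t. (J *v (t *\<^sub>R axis l 1)) $ l)) (at (w $ l))"
      by simp
    moreover have "(\<lambda>t. (J *v (t *\<^sub>R axis l 1)) $ l) = (*) (a $ l)"
      by (auto simp: a_def matrix_vector_mult_def axis_def if_distrib cong: if_cong)
    ultimately show ?thesis
      by (simp add: has_field_derivative_def)
  qed
  then have "((\<lambda>x. \<chi> l. g (x $ l)) has_derivative (*v) (diag_mat a)) (at w)"
    by (rule has_derivative_componentwise_map)
  with * have "(*v) J = (*v) (diag_mat a)"
    by (rule has_derivative_unique)
  then have "J = diag_mat a"
    by (metis matrix_eq)
  with 1 show "\<exists>a. (\<forall>l. (g has_real_derivative a $ l) (at (w $ l))) \<and> J = diag_mat a"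
    by blast
qed (auto intro: has_derivative_componentwise_map)

lemma has_derivative_matrix_conjugate:
  fixes G :: "'n::finite rvec \<Rightarrow> 'n rvec" and R S :: "'n rmat"
  assumes "(G has_derivative (*v) J) (at (S *v v))"
  shows "((\<lambda>u. R *v G (S *v u)) has_derivative (*v) (R ** J ** S)) (at v)"
proof -
  have lin: "((*v) M has_derivative (*v) M) (at x)" for M :: "'n rmat" and x
    by (rule bounded_linear_imp_has_derivative) simp
  have "((\<lambda>u. R *v G (S *v u)) has_derivative (\<lambda>h. R *v (J *v (S *v h)))) (at v)"
    by (rule has_derivative_compose[OF has_derivative_compose[OF lin assms] lin])
  then show ?thesis
    by (simp add: matrix_vector_mul_assoc matrix_mul_assoc)
qed

lemma has_derivative_conjugate_componentwise_iff:
  fixes R S J :: "'n::finite rmat"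
  assumes RS: "R ** S = mat 1"
  shows "((\<lambda>u. R *v (\<chi> l. g ((S *v u) $ l))) has_derivative (*v) J) (at v) \<longleftrightarrow>
    (\<exists>a. (\<forall>l. (g has_real_derivative a $ l) (at ((S *v v) $ l))) \<and> J = R ** diag_mat a ** S)"
    (is "(?f has_derivative _) _ \<longleftrightarrow> _")
proof -
  let ?G = "\<lambda>x::'n rvec. \<chi> l. g (x $ l)"
  have SR: "S ** R = mat 1"
    using RS matrix_left_right_inverse by blast
  have "(?f has_derivative (*v) J) (at v) \<longleftrightarrow> (?G has_derivative (*v) (S ** J ** R)) (at (S *v v))"
  proof
    assume "(?f has_derivative (*v) J) (at v)"
    \<comment> \<open>Writing \<open>v\<close> as \<open>R *v (S *v v)\<close> lets the conjugation
      lemma be applied to \<open>?f\<close> with \<open>R\<close> and \<open>S\<close> exchanged,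
      which undoes the conjugation.\<close>
    then have "(?f has_derivative (*v) J) (at (R *v (S *v v)))"
      by (simp add: matrix_vector_mul_assoc RS)
    from has_derivative_matrix_conjugate[OF this, of S]
    show "(?G has_derivative (*v) (S ** J ** R)) (at (S *v v))"
      by (simp add: matrix_vector_mul_assoc SR)
  next
    assume "(?G has_derivative (*v) (S ** J ** R)) (at (S *v v))"
    from has_derivative_matrix_conjugate[OF this, of R]
    show "(?f has_derivative (*v) J) (at v)"
      by (metis RS matrix_mul_assoc matrix_mul_lid matrix_mul_rid)
  qed
  moreover have "S ** J ** R = diag_mat a \<longleftrightarrow> J = R ** diag_mat a ** S" for a
    by (metis RS SR matrix_mul_assoc matrix_mul_lid matrix_mul_rid)
  ultimately show ?thesis
    by (simp add: has_derivative_componentwise_map_iff)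
qed

text \<open>A product set is a Minkowski sum of subsets of the coordinate axes, and the convex hull
  commutes with Minkowski sums and with linear images.\<close>

lemma convex_hull_vec_product:
  fixes B :: "'n::finite \<Rightarrow> real set"
  shows "convex hull {a :: 'n rvec. \<forall>l. a $ l \<in> B l} = {a. \<forall>l. a $ l \<in> convex hull (B l)}"
proof -
  \<comment> \<open>The family is reindexed by basis vectors, over which the Minkowski sum runs;
    \<open>axis\<close> is injective in the index, so the description is unique there.\<close>
  define C where "C i = B (THE l. i = axis l (1::real))" for i :: "'n rvec"
  have C: "C (axis l 1) = B l" for l
    by (simp add: C_def axis_eq_axis)
  have box: "{a. \<forall>l. a $ l \<in> D (axis l 1)} = (\<Sum>i\<in>Basis. (\<lambda>x. x *\<^sub>R i) ` D i)"
    for D :: "'n rvec \<Rightarrow> real set"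
    by (subst box_eq_set_sum_Basis[symmetric]) (auto simp: Basis_vec_def inner_axis)
  have "convex hull {a. \<forall>l. a $ l \<in> C (axis l 1)} = (\<Sum>i\<in>Basis. convex hull ((\<lambda>x. x *\<^sub>R i) ` C i))"
    by (simp only: box convex_hull_set_sum)
  also have "\<dots> = (\<Sum>i\<in>Basis. (\<lambda>x. x *\<^sub>R i) ` (convex hull C i))"
    by (simp add: convex_hull_linear_image)
  also have "\<dots> = {a. \<forall>l. a $ l \<in> convex hull (C (axis l 1))}"
    by (rule box[of "\<lambda>i. convex hull (C i)", symmetric])
  finally show ?thesis
    by (simp add: C)
qed

lemma generalized_jacobian_conjugate_componentwise:
  fixes R S :: "'n::finite rmat"
  assumes RS: "R ** S = mat 1"
  shows "generalized_jacobian (\<lambda>u. R *v (\<chi> l. g ((S *v u) $ l))) v =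
    {R ** diag_mat a ** S | a. \<forall>l. a $ l \<in> generalized_gradient g ((S *v v) $ l)}"
proof -
  define T where "T x = {c. \<exists>v dv. v \<longlonglongrightarrow> x \<and>
      (\<forall>m::nat. (g has_real_derivative dv m) (at (v m))) \<and> dv \<longlonglongrightarrow> c}" for x
  define \<Phi> where "\<Phi> a = R ** diag_mat a ** S" for a
  let ?f = "\<lambda>u. R *v (\<chi> l. g ((S *v u) $ l))"
  define L where "L = {J. \<exists>w Jw. w \<longlonglongrightarrow> v \<and>
      (\<forall>m::nat. (?f has_derivative (\<lambda>h. Jw m *v h)) (at (w m))) \<and> Jw \<longlonglongrightarrow> J}"
  have SR: "S ** R = mat 1"
    using RS matrix_left_right_inverse by blast
  have lin: "linear \<Phi>"
    unfolding \<Phi>_def by (rule linear_diag_mat_conjugate)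
  have tendsto_mult: "(\<lambda>m. M *v x m) \<longlonglongrightarrow> M *v y" if "x \<longlonglongrightarrow> y" for M :: "'n rmat" and x y
    using that by (rule bounded_linear.tendsto[rotated]) simp
  have tendsto_Phi: "(\<lambda>m. \<Phi> (x m)) \<longlonglongrightarrow> \<Phi> y" if "x \<longlonglongrightarrow> y" for x y
    by (rule bounded_linear.tendsto[OF linear_conv_bounded_linear[THEN iffD1, OF lin] that])
  have "L = \<Phi> ` {a. \<forall>l. a $ l \<in> T ((S *v v) $ l)}"
  proof (intro equalityI subsetI)
    fix J
    assume "J \<in> L"
    then obtain w Jw where w: "w \<longlonglongrightarrow> v"
      and der: "\<And>m. (?f has_derivative (*v) (Jw m)) (at (w m))" and Jw: "Jw \<longlonglongrightarrow> J"
      unfolding L_def by auto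
    from der have "\<forall>m. \<exists>a. (\<forall>l. (g has_real_derivative a $ l) (at ((S *v w m) $ l))) \<and> Jw m = \<Phi> a"
      by (simp add: has_derivative_conjugate_componentwise_iff[OF RS] \<Phi>_def)
    then obtain a where a: "\<And>m l. (g has_real_derivative a m $ l) (at ((S *v w m) $ l))"
      and Jwa: "\<And>m. Jw m = \<Phi> (a m)"
      by metis
    \<comment> \<open>A continuous left inverse of \<open>\<Phi>\<close>: convergence of the
      matrices \<open>Jw\<close> thereby yields convergence of the diagonals
      \<open>a\<close>.\<close>
    have entry: "linear (\<lambda>M. (S ** M ** R) $ l $ l)" for l
      by (rule linearI) (simp_all add: matrix_add_ldistrib matrix_add_rdistrib matrix_scalar_ac
          flip: scalar_matrix_assoc)
    have inv: "(S ** \<Phi> b ** R) $ l $ l = b $ l" for b l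
    proof -
      have "S ** \<Phi> b ** R = diag_mat b"
        unfolding \<Phi>_def by (metis SR matrix_mul_assoc matrix_mul_lid matrix_mul_rid)
      then show ?thesis
        by (simp add: diag_mat_def)
    qed
    define b where "b = (\<chi> l. (S ** J ** R) $ l $ l)"
    have ab: "(\<lambda>m. a m $ l) \<longlonglongrightarrow> b $ l" for l
    proof -
      have "(\<lambda>m. (S ** Jw m ** R) $ l $ l) \<longlonglongrightarrow> (S ** J ** R) $ l $ l"
        by (rule bounded_linear.tendsto[OF linear_conv_bounded_linear[THEN iffD1, OF entry] Jw])
      then show ?thesis
        by (simp add: Jwa inv b_def)
    qed
    then have "a \<longlonglongrightarrow> b"
      by (rule vec_tendstoI)
    then have "Jw \<longlonglongrightarrow> \<Phi> b"
      using tendsto_Phi Jwa by presburger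
    then have "J = \<Phi> b"
      using Jw LIMSEQ_unique by blast
    moreover have "b $ l \<in> T ((S *v v) $ l)" for l
      unfolding T_def
      by (intro CollectI exI[of _ "\<lambda>m. (S *v w m) $ l"] exI[of _ "\<lambda>m. a m $ l"] conjI allI
          a ab tendsto_vec_nth[OF tendsto_mult[OF w]])
    ultimately show "J \<in> \<Phi> ` {a. \<forall>l. a $ l \<in> T ((S *v v) $ l)}"
      by blast
  next
    fix J
    assume "J \<in> \<Phi> ` {a. \<forall>l. a $ l \<in> T ((S *v v) $ l)}"
    then obtain b where J: "J = \<Phi> b" and "\<And>l. b $ l \<in> T ((S *v v) $ l)"
      by blast
    then obtain y dy where y: "\<And>l. y l \<longlonglongrightarrow> (S *v v) $ l"
      and der: "\<And>l m. (g has_real_derivative dy l m) (at (y l m))"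
      and dy: "\<And>l. dy l \<longlonglongrightarrow> b $ l"
      unfolding T_def mem_Collect_eq by metis
    \<comment> \<open>The components have independent approximating sequences. Their
      \<open>m\<close>-th terms together form one point, and \<open>R\<close> carries it back; so
      every combination of componentwise limits occurs.\<close>
    define w where "w m = R *v (\<chi> l. y l m)" for m
    have Sw: "S *v w m = (\<chi> l. y l m)" for m
      by (simp add: w_def matrix_vector_mul_assoc SR)
    have "(\<lambda>m. \<chi> l. y l m) \<longlonglongrightarrow> S *v v"
      by (rule vec_tendstoI) (simp add: y)
    from tendsto_mult[OF this, of R] have "w \<longlonglongrightarrow> v"
      by (simp add: w_def[abs_def] matrix_vector_mul_assoc RS)
    moreover have "(?f has_derivative (*v) (\<Phi> (\<chi> l. dy l m))) (at (w m))" for m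
      unfolding has_derivative_conjugate_componentwise_iff[OF RS] Sw \<Phi>_def
      using der by (intro exI[of _ "\<chi> l. dy l m"]) simp
    moreover have "(\<lambda>m. \<Phi> (\<chi> l. dy l m)) \<longlonglongrightarrow> J"
      unfolding J by (intro tendsto_Phi vec_tendstoI) (simp add: dy)
    ultimately show "J \<in> L"
      unfolding L_def
      by (intro CollectI exI[of _ w] exI[of _ "\<lambda>m. \<Phi> (\<chi> l. dy l m)"]) simp
  qed
  then have "convex hull L = \<Phi> ` {a. \<forall>l. a $ l \<in> convex hull (T ((S *v v) $ l))}"
    by (simp add: convex_hull_linear_image[OF lin] flip: convex_hull_vec_product)
  then show ?thesis
    unfolding generalized_jacobian_def generalized_gradient_def L_def T_def \<Phi>_def by auto
qed

section \<open>Generalized gradients of the scalar flux and of the absolute value\<close>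

lemma scalar_flux_has_derivative_iff:
  "(scalar_flux has_real_derivative c) (at x) \<longleftrightarrow> (abs has_real_derivative c - 2 * x) (at x)"
proof
  assume "(scalar_flux has_real_derivative c) (at x)"
  then have "((\<lambda>y. scalar_flux y - y\<^sup>2) has_real_derivative c - 2 * x) (at x)"
    by (auto intro!: derivative_eq_intros)
  then show "(abs has_real_derivative c - 2 * x) (at x)"
    by (simp add: scalar_flux_def)
next
  assume "(abs has_real_derivative c - 2 * x) (at x)"
  then have "((\<lambda>y. y\<^sup>2 + \<bar>y\<bar>) has_real_derivative c) (at x)"
    by (auto intro!: derivative_eq_intros)
  then show "(scalar_flux has_real_derivative c) (at x)"
    by (simp add: scalar_flux_def[abs_def])
qed

text \<open>The sum rule is an equality because the square contributes \<open>2 * v m\<close>, which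
  converges to \<open>2 * x\<close> along every admissible sequence; the resulting translation
  passes through the hull.\<close>

lemma generalized_gradient_scalar_flux:
  "generalized_gradient scalar_flux x = (+) (2 * x) ` generalized_gradient abs x"
proof -
  define T where "T f = {c. \<exists>v dv. v \<longlonglongrightarrow> x \<and>
      (\<forall>m::nat. (f has_real_derivative dv m) (at (v m))) \<and> dv \<longlonglongrightarrow> c}" for f :: "real \<Rightarrow> real"
  have "T scalar_flux = (+) (2 * x) ` T abs"
  proof (intro equalityI subsetI)
    fix c
    assume "c \<in> T scalar_flux"
    then obtain v dv where v: "v \<longlonglongrightarrow> x" "dv \<longlonglongrightarrow> c"
      "\<And>m. (abs has_real_derivative dv m - 2 * v m) (at (v m))"
      unfolding T_def scalar_flux_has_derivative_iff by auto
    moreover have "(\<lambda>m. dv m - 2 * v m) \<longlonglongrightarrow> c - 2 * x"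
      by (intro tendsto_intros v)
    ultimately have "c - 2 * x \<in> T abs"
      unfolding T_def by (intro CollectI exI[of _ v] exI[of _ "\<lambda>m. dv m - 2 * v m"]) simp
    then show "c \<in> (+) (2 * x) ` T abs"
      by force
  next
    fix c
    assume "c \<in> (+) (2 * x) ` T abs"
    then obtain v dv where v: "v \<longlonglongrightarrow> x" "dv \<longlonglongrightarrow> c - 2 * x"
      "\<And>m. (abs has_real_derivative dv m) (at (v m))"
      unfolding T_def by auto
    have "(\<lambda>m. 2 * v m + dv m) \<longlonglongrightarrow> 2 * x + (c - 2 * x)"
      by (intro tendsto_intros v)
    moreover have "(scalar_flux has_real_derivative 2 * v m + dv m) (at (v m))" for m
      using v(3) by (simp add: scalar_flux_has_derivative_iff)
    ultimately show "c \<in> T scalar_flux"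
      unfolding T_def using v(1)
      by (intro CollectI exI[of _ v] exI[of _ "\<lambda>m. 2 * v m + dv m"]) simp
  qed
  then show ?thesis
    unfolding generalized_gradient_def T_def[symmetric] by (simp add: convex_hull_translation)
qed

lemma abs_has_real_derivative_sgn:
  fixes y :: real
  assumes "y \<noteq> 0"
  shows "(abs has_real_derivative sgn y) (at y)"
proof (rule has_field_derivative_transform_within_open)
  show "((\<lambda>z. sgn y * z) has_real_derivative sgn y) (at y)"
    by (auto intro!: derivative_eq_intros)
  show "open {z. 0 < sgn y * z}"
    by (intro open_Collect_less continuous_intros)
qed (use assms in \<open>auto simp: sgn_if abs_if split: if_splits\<close>)

text \<open>A nonzero \<open>x\<close> is a point of differentiability. At 0 the value
  \<open>sgn 0 = 0\<close> enters only through the convex hull.\<close>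

lemma sgn_in_generalized_gradient_abs: "sgn x \<in> generalized_gradient abs x"
proof -
  define T where "T = {c. \<exists>v dv. v \<longlonglongrightarrow> x \<and>
      (\<forall>m::nat. (abs has_real_derivative dv m) (at (v m))) \<and> dv \<longlonglongrightarrow> c}"
  have "sgn x \<in> convex hull T"
  proof (cases "x = 0")
    case False
    then have "sgn x \<in> T"
      unfolding T_def using abs_has_real_derivative_sgn[OF False]
      by (intro CollectI exI[of _ "\<lambda>_. x"] exI[of _ "\<lambda>_. sgn x"]) simp
    then show ?thesis
      by (simp add: hull_inc)
  next
    case True
    \<comment> \<open>The points s / (m + 1) approach 0 from the side of sign \<open>s\<close>,
      where the derivative is constantly \<open>s\<close>.\<close>
    have in_T: "s \<in> T" if "\<bar>s\<bar> = 1" for s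
    proof -
      have "(\<lambda>m. s * inverse (real (Suc m))) \<longlonglongrightarrow> s * 0"
        by (intro tendsto_intros LIMSEQ_inverse_real_of_nat)
      moreover have "(abs has_real_derivative s) (at (s * inverse (real (Suc m))))" for m
        using abs_has_real_derivative_sgn[of "s * inverse (real (Suc m))"] that
        by (auto simp: sgn_mult abs_if split: if_splits)
      ultimately show ?thesis
        unfolding T_def True
        by (intro CollectI exI[of _ "\<lambda>m. s * inverse (real (Suc m))"] exI[of _ "\<lambda>_. s"]) simp
    qed
    have "(1/2) *\<^sub>R 1 + (1/2) *\<^sub>R (-1) \<in> convex hull T"
      by (rule convexD[OF convex_convex_hull]) (simp_all add: hull_inc in_T)
    then show ?thesis
      by (simp add: True)
  qed
  then show ?thesis
    unfolding generalized_gradient_def T_def .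
qed

section \<open>Orthogonality of Haar-type matrices\<close>

text \<open>Counting predecessors is strictly increasing, hence injective, into a set of equal
  cardinality. This transports sums over the index type to sums over numbers.\<close>

lemma bij_betw_idx: "bij_betw (idx :: 'n::{finite,linorder} \<Rightarrow> nat) UNIV {..<CARD('n)}"
proof -
  have "strict_mono (idx :: 'n \<Rightarrow> nat)"
    unfolding strict_mono_def idx_def by (auto intro!: psubset_card_mono)
  then have inj: "inj (idx :: 'n \<Rightarrow> nat)"
    by (rule strict_mono_imp_inj_on)
  have "range (idx :: 'n \<Rightarrow> nat) \<subseteq> {..<CARD('n)}"
    unfolding idx_def by (auto intro!: psubset_card_mono)
  then show ?thesis
    using inj by (simp add: bij_betw_def card_subset_eq card_image)
qed

lemma idx_eq_iff: "idx (i :: 'n::{finite,linorder}) = idx j \<longleftrightarrow> i = j"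
  using bij_betw_imp_inj_on[OF bij_betw_idx[where 'n = 'n]] by (rule inj_eq)

lemma idx_less_CARD: "idx (i :: 'n::{finite,linorder}) < CARD('n)"
  using bij_betwE[OF bij_betw_idx] by blast

lemma ex_idx:
  assumes "k < CARD('n)"
  obtains i :: "'n::{finite,linorder}" where "idx i = k"
proof -
  have "k \<in> range (idx :: 'n \<Rightarrow> nat)"
    using assms bij_betw_imp_surj_on[OF bij_betw_idx[where 'n = 'n]] by simp
  with that show ?thesis
    by blast
qed

lemma sum_idx: "(\<Sum>i\<in>UNIV. f (idx (i :: 'n::{finite,linorder}))) = sum f {..<CARD('n)}"
  by (rule sum.reindex_bij_betw[OF bij_betw_idx])

text \<open>A row consists of zeros, one entry \<open>haar_hd i\<close> and a constant tail, so it
  sees \<open>f\<close> only through one value and one tail sum. Taking \<open>f\<close> to be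
  another row gives orthogonality, the row itself gives the norm.\<close>

lemma sum_canonical_haar_row:
  fixes i :: "'n::{finite,linorder}"
  assumes "idx i \<noteq> 0"
  shows "(\<Sum>l\<in>UNIV. canonical_haar $ i $ l * f (idx l)) =
    haar_hd i * f (idx i - 1) + haar_hr i * (\<Sum>k=idx i..<CARD('n). f k)"
proof -
  define m where "m = idx i"
  have m: "0 < m" "m < CARD('n)"
    using assms idx_less_CARD[of i] by (auto simp: m_def)
  define c where "c k = (if k + 1 < m then 0 else if k + 1 = m then haar_hd i else haar_hr i)" for k
  have "(\<Sum>l\<in>UNIV. canonical_haar $ i $ l * f (idx l)) = (\<Sum>l::'n\<in>UNIV. c (idx l) * f (idx l))"
    using assms by (intro sum.cong) (auto simp: canonical_haar_def c_def m_def)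
  also have "\<dots> = (\<Sum>k<CARD('n). c k * f k)"
    by (rule sum_idx)
  also have "\<dots> = (\<Sum>k<m - 1. c k * f k) + (\<Sum>k=m - 1..<CARD('n). c k * f k)"
    using m by (subst sum.atLeastLessThan_concat[of 0 "m - 1", simplified lessThan_atLeast0[symmetric], symmetric])
      (auto simp: lessThan_atLeast0)
  also have "(\<Sum>k=m - 1..<CARD('n). c k * f k) = c (m - 1) * f (m - 1) + (\<Sum>k=m..<CARD('n). c k * f k)"
    using m by (subst sum.atLeast_Suc_lessThan) auto
  also have "(\<Sum>k<m - 1. c k * f k) = 0"
    by (rule sum.neutral) (auto simp: c_def)
  also have "c (m - 1) = haar_hd i"
    using m by (simp add: c_def)
  also have "(\<Sum>k=m..<CARD('n). c k * f k) = haar_hr i * (\<Sum>k=m..<CARD('n). f k)"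
    by (auto simp: c_def sum_distrib_left intro!: sum.cong)
  finally show ?thesis
    by (simp add: m_def)
qed

text \<open>
  Every row is constant on the support of each later row, and all rows but the first have sum zero.
\<close>

lemma canonical_haar_orthogonal:
  "canonical_haar ** transpose canonical_haar = real CARD('n) *\<^sub>R (mat 1 :: 'n::{finite,linorder} rmat)"
proof -
  define c where "c i k = (if idx i = 0 then 1 else if k + 1 < idx i then 0
      else if k + 1 = idx i then haar_hd i else haar_hr i)" for i :: 'n and k
  have c: "canonical_haar $ i $ l = c i (idx l)" for i l :: 'n
    by (simp add: canonical_haar_def c_def)
  \<comment> \<open>The tail of row \<open>i\<close> has \<open>- haar_s i\<close> columns. Hence
    \<open>haar_hd i = haar_s i * haar_hr i\<close> makes the entry before the tail cancel the tail
    sum.\<close>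
  have s: "real (CARD('n) - idx i) = - haar_s i" for i :: 'n
    using idx_less_CARD[of i] by (simp add: haar_s_def of_nat_diff)
  have row_less: "(\<Sum>l\<in>UNIV. canonical_haar $ i $ l * canonical_haar $ j $ l) = 0"
    if "idx j < idx i" for i j :: 'n
  proof -
    define r where "r = c j (idx i)"
    have r: "c j k = r" if "idx i \<le> k + 1" for k
      using that \<open>idx j < idx i\<close> by (auto simp: c_def r_def)
    have "(\<Sum>l\<in>UNIV. canonical_haar $ i $ l * c j (idx l)) =
        haar_hd i * r + haar_hr i * (\<Sum>k=idx i..<CARD('n). r)"
      using that by (subst sum_canonical_haar_row) (simp_all add: r)
    also have "\<dots> = 0"
      by (simp add: s haar_hd_def)
    finally show ?thesis
      by (simp add: c)
  qed
  have row_eq: "(\<Sum>l\<in>UNIV. canonical_haar $ i $ l * canonical_haar $ i $ l) = real CARD('n)" for i :: 'n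
  proof (cases "idx i = 0")
    case True
    then show ?thesis
      by (simp add: c c_def)
  next
    case False
    \<comment> \<open>The squared length is
      \<open>(haar_hr i)\<^sup>2 * ((haar_s i)\<^sup>2 - haar_s i)\<close>, which
      \<open>haar_hr\<close> is normalised for; the bound makes the last factor, and so the
      radicand, positive.\<close>
    have "haar_s i \<le> -1"
      using idx_less_CARD[of i] by (simp add: haar_s_def)
    then have pos: "(haar_s i)\<^sup>2 - haar_s i > 0"
      by (smt (verit) zero_le_power2)
    have "(\<Sum>l\<in>UNIV. canonical_haar $ i $ l * c i (idx l)) =
        haar_hd i * c i (idx i - 1) + haar_hr i * (\<Sum>k=idx i..<CARD('n). c i k)"
      by (rule sum_canonical_haar_row[OF False])
    also have "(\<Sum>k=idx i..<CARD('n). c i k) = (\<Sum>k=idx i..<CARD('n). haar_hr i)"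
      using False by (intro sum.cong) (auto simp: c_def)
    also have "c i (idx i - 1) = haar_hd i"
      using False by (simp add: c_def)
    also have "haar_hd i * haar_hd i + haar_hr i * (\<Sum>k=idx i..<CARD('n). haar_hr i) =
        (haar_hr i)\<^sup>2 * ((haar_s i)\<^sup>2 - haar_s i)"
      by (simp add: s haar_hd_def power2_eq_square algebra_simps)
    also have "\<dots> = real CARD('n)"
      using pos by (simp add: haar_hr_def)
    finally show ?thesis
      by (simp add: c)
  qed
  have "(\<Sum>l\<in>UNIV. canonical_haar $ i $ l * canonical_haar $ j $ l) =
      (if i = j then real CARD('n) else 0)" for i j :: 'n
  proof -
    consider "i = j" | "idx i < idx j" | "idx j < idx i"
      using idx_eq_iff[of i j] by linarith
    then show ?thesis
    proof cases
      case 1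
      then show ?thesis
        by (simp add: row_eq)
    next
      case 2
      then show ?thesis
        using row_less[of i j] by (auto simp: mult.commute)
    next
      case 3
      then show ?thesis
        using row_less[of j i] by auto
    qed
  qed
  then show ?thesis
    by (simp add: vec_eq_iff matrix_matrix_mult_def transpose_def mat_def)
qed

lemma block_one_orthogonal:
  assumes "orthogonal_upto (CARD('n) - 1) Om"
  shows "block_one Om ** transpose (block_one Om) = (mat 1 :: 'n::{finite,linorder} rmat)"
proof -
  define b where "b i k = (if i = 0 \<and> k = 0 then 1 else if i = 0 \<or> k = 0 then 0 else Om i k)" for i k
  have "(\<Sum>l\<in>UNIV. block_one Om $ i $ l * block_one Om $ j $ l) = (if i = j then 1 else 0)"
    for i j :: 'n
  proof -
    have "(\<Sum>l\<in>UNIV. block_one Om $ i $ l * block_one Om $ j $ l) =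
        (\<Sum>l::'n\<in>UNIV. b (idx i) (idx l) * b (idx j) (idx l))"
      by (simp add: block_one_def b_def)
    also have "\<dots> = (\<Sum>k<CARD('n). b (idx i) k * b (idx j) k)"
      by (rule sum_idx)
    \<comment> \<open>Once index 0 is split off, the range is the index set of \<open>Om\<close>,
      which is empty when \<open>CARD('n)\<close> is 1.\<close>
    also have "{..<CARD('n)} = insert 0 {1..CARD('n) - 1}"
      using idx_less_CARD[of i] by auto
    also have "(\<Sum>k\<in>\<dots>. b (idx i) k * b (idx j) k) =
        b (idx i) 0 * b (idx j) 0 + (\<Sum>k=1..CARD('n) - 1. b (idx i) k * b (idx j) k)"
      by simp
    also have "\<dots> = (if idx i = idx j then 1 else 0)"
    proof (cases "idx i = 0 \<or> idx j = 0")
      case True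
      then have "(\<Sum>k=1..CARD('n) - 1. b (idx i) k * b (idx j) k) = 0"
        by (intro sum.neutral) (auto simp: b_def)
      then show ?thesis
        using True by (auto simp: b_def)
    next
      case False
      then have "(\<Sum>k=1..CARD('n) - 1. b (idx i) k * b (idx j) k) =
          (\<Sum>k=1..CARD('n) - 1. Om (idx i) k * Om (idx j) k)"
        by (intro sum.cong) (auto simp: b_def)
      moreover have "idx i \<in> {1..CARD('n) - 1}" "idx j \<in> {1..CARD('n) - 1}"
        using False idx_less_CARD[of i] idx_less_CARD[of j] by auto
      ultimately show ?thesis
        using assms False by (simp add: orthogonal_upto_def b_def)
    qed
    finally show ?thesis
      by (simp add: idx_eq_iff)
  qed
  then show ?thesis
    by (simp add: vec_eq_iff matrix_matrix_mult_def transpose_def mat_def)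
qed

lemma haar_type_orthogonal:
  fixes A :: "'n::{finite,linorder} rmat"
  assumes "haar_type A"
  shows "A ** transpose A = real CARD('n) *\<^sub>R mat 1"
proof -
  obtain Om where Om: "orthogonal_upto (CARD('n) - 1) Om" and A: "A = block_one Om ** canonical_haar"
    using assms by (auto simp: haar_type_def)
  have "A ** transpose A =
      block_one Om ** (canonical_haar ** transpose canonical_haar) ** transpose (block_one Om)"
    by (simp add: A matrix_transpose_mul matrix_mul_assoc)
  also have "\<dots> = real CARD('n) *\<^sub>R (block_one Om ** transpose (block_one Om))"
    by (simp add: canonical_haar_orthogonal matrix_scalar_ac flip: scalar_matrix_assoc)
  finally show ?thesis
    by (simp add: block_one_orthogonal[OF Om])
qed

lemma haar_type_first_row:
  fixes A :: "'n::{finite,linorder} rmat"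
  assumes "haar_type A" "idx i = 0"
  shows "A $ i $ l = 1"
proof -
  obtain Om where A: "A = block_one Om ** canonical_haar"
    using assms by (auto simp: haar_type_def)
  have "block_one Om $ i $ k = (if k = i then 1 else 0)" for k
    using idx_eq_iff[of k i] assms(2) by (simp add: block_one_def)
  then have "A $ i $ l = (\<Sum>k\<in>UNIV. if k = i then canonical_haar $ k $ l else 0)"
    unfolding A matrix_matrix_mult_def vec_lambda_beta by (intro sum.cong) simp_all
  then show ?thesis
    using assms(2) by (simp add: canonical_haar_def)
qed

text \<open>Row 0 of \<open>A\<close> consists of ones, so \<open>e1\<close> holds the modes of the
  constant function 1. This is why applying a conjugated diagonal matrix to \<open>e1\<close>, as in
  \<open>sign_modes\<close>, yields modes whose cell values are the diagonal.\<close>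

lemma haar_type_transpose_e1:
  fixes A :: "'n::{finite,linorder} rmat"
  assumes "haar_type A"
  shows "transpose A *v e1 = (\<chi> l. 1)"
proof -
  obtain i :: 'n where i: "idx i = 0"
    using ex_idx[OF zero_less_card_finite] .
  have e1: "e1 = (axis i 1 :: 'n rvec)"
  proof (rule vec_eq_iff[THEN iffD2], rule allI)
    show "e1 $ j = (axis i 1 :: 'n rvec) $ j" for j
      using idx_eq_iff[of j i] i by (simp add: e1_def axis_def)
  qed
  show ?thesis
    unfolding e1
    by (simp add: matrix_vector_mul_component inner_axis transpose_def vec_eq_iff
        haar_type_first_row[OF assms i])
qed

section \<open>Step functions and the Galerkin matrix\<close>

text \<open>The values are a free parameter, so that basis functions (\<open>p\<close> a row of
  \<open>A\<close>) and expansions (\<open>p\<close> given by \<open>transpose A *v u\<close>) are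
  instances of one notion.\<close>

definition haar_step :: "('n::{finite,linorder} \<Rightarrow> real) \<Rightarrow> real \<Rightarrow> real" where
  "haar_step p \<xi> = (\<Sum>l\<in>UNIV. p l * indicator {0..1} (real CARD('n) * \<xi> - real (idx l)))"

lemma haar_step_cell:
  "(indicator {0..1} (real CARD('n) * \<xi> - real (idx (l::'n::{finite,linorder}))) :: real) =
    indicator {real (idx l) / real CARD('n)..(real (idx l) + 1) / real CARD('n)} \<xi>"
  by (auto simp: indicator_def field_simps)

lemma haar_step_measurable [measurable]: "haar_step p \<in> borel_measurable borel"
  unfolding haar_step_def[abs_def] haar_step_cell by measurable

lemma prob_space_law_xi: "prob_space law_xi"
  unfolding law_xi_def by (rule prob_space_uniform_measure) auto

lemma sets_law_xi [measurable_cong, simp]: "sets law_xi = sets borel"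
  by (simp add: law_xi_def)

text \<open>The law lives on the open unit interval, so the end points 0 and 1 may be lost; the
  measure is squeezed between those of the open and the closed interval.\<close>

lemma measure_law_xi_Icc:
  assumes "0 \<le> a" "a \<le> b" "b \<le> 1"
  shows "measure law_xi {a..b} = b - a"
proof -
  have fm: "{a..b} \<in> fmeasurable lborel"
    by (rule fmeasurableI) (use assms in auto)
  have "measure lborel ({0<..<1} \<inter> {a..b}) \<le> measure lborel {a..b}"
    by (rule measure_mono_fmeasurable) (use fm in auto)
  moreover have "measure lborel {a<..<b} \<le> measure lborel ({0<..<1} \<inter> {a..b})"
  proof (rule measure_mono_fmeasurable)
    show "{0<..<1} \<inter> {a..b} \<in> fmeasurable lborel"
      using fm by (subst Int_commute) (auto intro: fmeasurable_Int_fmeasurable)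
  qed (use assms in auto)
  ultimately show ?thesis
    using assms by (simp add: law_xi_def)
qed

lemma integral_haar_step:
  fixes p :: "'n::{finite,linorder} \<Rightarrow> real"
  shows "(\<integral>\<xi>. haar_step p \<xi> \<partial>law_xi) = sum p UNIV / real CARD('n)"
proof -
  interpret prob_space law_xi
    by (rule prob_space_law_xi)
  have "measure law_xi {real (idx l) / real CARD('n)..(real (idx l) + 1) / real CARD('n)} = 1 / real CARD('n)"
    for l :: 'n
    using idx_less_CARD[of l]
    by (subst measure_law_xi_Icc) (auto simp: field_simps)
  then show ?thesis
    unfolding haar_step_def haar_step_cell
    by (subst Bochner_Integration.integral_sum)
      (auto simp: sum_divide_distrib intro!: integrable_mult_right integrable_real_indicator simp: emeasure_eq_measure)
qed

text \<open>The cells are closed, so at an interior node both neighbouring values are added up; only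
  the finitely many nodes are removed. The cell \<open>l\<close> is chosen before \<open>p\<close>:
  all step functions are read off on the same cell, as products and compositions need.\<close>

lemma AE_haar_step: "AE \<xi> in law_xi. \<exists>l::'n::{finite,linorder}. \<forall>p. haar_step p \<xi> = p l"
  unfolding law_xi_def
proof (rule AE_uniform_measureI)
  let ?N = "real CARD('n)"
  have "AE \<xi> in lborel. \<xi> \<notin> (\<lambda>k. real k / ?N) ` {..CARD('n)}"
    by (rule AE_not_in) (auto intro!: finite_imp_null_set_lborel)
  then show "AE \<xi> in lborel. \<xi> \<in> {0<..<1} \<longrightarrow> (\<exists>l::'n. \<forall>p. haar_step p \<xi> = p l)"
  proof eventually_elim
    fix \<xi> :: real
    assume nodes: "\<xi> \<notin> (\<lambda>k. real k / ?N) ` {..CARD('n)}"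
    show "\<xi> \<in> {0<..<1} \<longrightarrow> (\<exists>l::'n. \<forall>p. haar_step p \<xi> = p l)"
    proof
      assume "\<xi> \<in> {0<..<1}"
      then have x: "0 < ?N * \<xi>" "?N * \<xi> < ?N"
        by auto
      define k where "k = nat \<lfloor>?N * \<xi>\<rfloor>"
      have k: "real k \<le> ?N * \<xi>" "?N * \<xi> < real k + 1"
        using x(1) by (auto simp: k_def)
      with x have kN: "k < CARD('n)"
        by linarith
      have ne: "?N * \<xi> \<noteq> real j" if "j \<le> CARD('n)" for j
        using nodes that by (auto simp: image_iff field_simps)
      obtain l :: 'n where l: "idx l = k"
        using ex_idx[OF kN] .
      \<comment> \<open>To the left of cell \<open>k\<close> the right end point of a neighbour is
        excluded by \<open>ne\<close>; to the right the floor gives strictness.\<close>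
      have "(indicator {0..1} (?N * \<xi> - real (idx m)) :: real) = (if m = l then 1 else 0)" for m :: 'n
      proof -
        consider "m = l" | "idx m < k" | "k < idx m"
          using idx_eq_iff[of m l] l by linarith
        then show ?thesis
        proof cases
          case 2
          then have "real (idx m) + 1 \<le> real k"
            by linarith
          then have "real (idx m) + 1 < ?N * \<xi>"
            using k ne[of k] kN by linarith
          then show ?thesis
            using 2 l by auto
        next
          case 3
          then have "real k + 1 \<le> real (idx m)"
            by linarith
          then show ?thesis
            using k l 3 by auto
        qed (use k l in auto)
      qed
      then have "haar_step p \<xi> = (\<Sum>m\<in>UNIV. p m * (if m = l then 1 else 0))" for p
        unfolding haar_step_def by presburger
      then show "\<exists>l::'n. \<forall>p. haar_step p \<xi> = p l"
        by (intro exI[of _ l]) (simp add: if_distrib cong: if_cong)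
    qed
  qed
qed simp

lemma haar_basis_eq_haar_step: "haar_basis A k = haar_step (($) (A $ k))"
  by (simp add: haar_basis_def haar_step_def fun_eq_iff)

lemma expansion_eq_haar_step: "expansion A u = haar_step (($) (transpose A *v u))"
proof
  fix \<xi>
  show "expansion A u \<xi> = haar_step (($) (transpose A *v u)) \<xi>"
    unfolding expansion_def haar_basis_def haar_step_def matrix_vector_mult_def transpose_def
      vec_lambda_beta sum_distrib_left sum_distrib_right
    by (subst sum.swap) (simp only: mult_ac)
qed

text \<open>The bound \<open>p\<close> in the second premise shadows the fixed one. Quantifying over
  all step functions there lets \<open>f\<close> combine several of them, while the exceptional null
  set is dealt with once.\<close>

lemma integral_composed_haar_step:
  fixes p :: "'n::{finite,linorder} \<Rightarrow> real"
  assumes [measurable]: "f \<in> borel_measurable borel"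
    and f: "\<And>\<xi> l. \<forall>p. haar_step p \<xi> = p l \<Longrightarrow> f \<xi> = p l"
  shows "(\<integral>\<xi>. f \<xi> \<partial>law_xi) = sum p UNIV / real CARD('n)"
proof -
  have "AE \<xi> in law_xi. f \<xi> = haar_step p \<xi>"
    using AE_haar_step[where 'n = 'n] by eventually_elim (use f in metis)
  then have "(\<integral>\<xi>. f \<xi> \<partial>law_xi) = (\<integral>\<xi>. haar_step p \<xi> \<partial>law_xi)"
    by (intro integral_cong_AE) auto
  then show ?thesis
    by (simp add: integral_haar_step)
qed

lemma modes_composed_expansion:
  fixes A :: "'n::{finite,linorder} rmat"
  assumes [measurable]: "F \<in> borel_measurable borel"
  shows "modes A (\<lambda>\<xi>. F (expansion A u \<xi>)) =
    ((1 / real CARD('n)) *\<^sub>R A) *v (\<chi> l. F ((transpose A *v u) $ l))"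
proof -
  have "inner_P (\<lambda>\<xi>. F (expansion A u \<xi>)) (haar_basis A k) =
      (\<Sum>l\<in>UNIV. F ((transpose A *v u) $ l) * A $ k $ l) / real CARD('n)" for k
    unfolding inner_P_def expansion_eq_haar_step haar_basis_eq_haar_step
    by (rule integral_composed_haar_step) auto
  then show ?thesis
    by (simp add: modes_def vec_eq_iff matrix_vector_mult_def sum_divide_distrib mult_ac)
qed

lemma galerkin_M_entry:
  fixes A :: "'n::{finite,linorder} rmat"
  shows "galerkin_M A k $ i $ j = (\<Sum>l\<in>UNIV. A $ k $ l * (A $ i $ l * A $ j $ l)) / real CARD('n)"
  unfolding galerkin_M_def inner_P_def haar_basis_eq_haar_step vec_lambda_beta
  by (rule integral_composed_haar_step) auto

text \<open>Integrating the triple products cell by cell leaves a sum over modes and cells;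
  exchanging the two collects the cell values of the expansion on the diagonal.\<close>

lemma galerkin_P_conjugate:
  "galerkin_P A u = ((1 / real CARD('n)) *\<^sub>R A) ** diag_mat (transpose A *v u) **
    transpose (A :: 'n::{finite,linorder} rmat)"
proof -
  have "(((1 / real CARD('n)) *\<^sub>R A) ** diag_mat (transpose A *v u) ** transpose A) $ i $ j =
      (\<Sum>l\<in>UNIV. A $ i $ l * (\<Sum>k\<in>UNIV. A $ k $ l * u $ k) * A $ j $ l / real CARD('n))" for i j
    by (simp add: matrix_matrix_mult_def diag_mat_def matrix_vector_mult_def transpose_def
        if_distrib if_distribR cong: if_cong)
  moreover have "galerkin_P A u $ i $ j =
      (\<Sum>k\<in>UNIV. \<Sum>l\<in>UNIV. A $ i $ l * (A $ k $ l * u $ k) * A $ j $ l / real CARD('n))" for i j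
    by (simp add: galerkin_P_def galerkin_M_entry sum_distrib_left sum_divide_distrib mult_ac)
  ultimately show ?thesis
    unfolding vec_eq_iff sum_distrib_left sum_distrib_right sum_divide_distrib
    by (subst (asm) sum.swap) simp
qed

section \<open>The stochastic Galerkin formulation\<close>

text \<open>The two factors \<open>1 / sqrt (real CARD('n))\<close> merge into one, which links the
  orthogonal form to the inverse pair used for the flux.\<close>

lemma haar_H_conjugate:
  fixes A :: "'n::{finite,linorder} rmat"
  shows "haar_H A ** X ** transpose (haar_H A) = ((1 / real CARD('n)) *\<^sub>R A) ** X ** transpose A"
proof -
  have "transpose (haar_H A) = (1 / sqrt (real CARD('n))) *\<^sub>R transpose A"
    by (simp add: haar_H_def transpose_def vec_eq_iff)
  then show ?thesis
    by (simp add: haar_H_def matrix_scalar_ac real_sqrt_mult_self flip: scalar_matrix_assoc)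
qed

context
  fixes A :: "'n::{finite,linorder} rmat"
  assumes haar: "haar_type A"
  \<comment> \<open>As a simp rule it would turn \<open>transpose A *v u\<close>, the form in which
    cell values are kept, into \<open>u v* A\<close>.\<close>
  notes transpose_matrix_vector [simp del]
begin

lemma haar_type_inverse: "((1 / real CARD('n)) *\<^sub>R A) ** transpose A = mat 1"
  by (simp add: haar_type_orthogonal[OF haar] flip: scalar_matrix_assoc)

lemma haar_type_inverse': "transpose A ** ((1 / real CARD('n)) *\<^sub>R A) = mat 1"
  using haar_type_inverse matrix_left_right_inverse by blast

lemma haar_H_orthogonal: "transpose (haar_H A) ** haar_H A = mat 1"
  using haar_H_conjugate[of A "mat 1"] haar_type_inverse matrix_left_right_inverse
  by (metis matrix_mul_rid)

lemma galerkin_P_eq_haar_H: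
  "galerkin_P A u = haar_H A ** diag_mat (transpose A *v u) ** transpose (haar_H A)"
  by (simp add: galerkin_P_conjugate haar_H_conjugate)

lemma galerkin_D_eq: "galerkin_D A u = diag_mat (transpose A *v u)"
  unfolding galerkin_D_def galerkin_P_eq_haar_H
  by (metis haar_H_orthogonal matrix_mul_assoc matrix_mul_lid matrix_mul_rid)

text \<open>\<open>transpose A\<close> cancels the left factor, and \<open>e1\<close> has all cell
  values 1, so the diagonal of signs remains.\<close>

lemma transpose_sign_modes: "transpose A *v sign_modes A u = (\<chi> l. sgn ((transpose A *v u) $ l))"
proof -
  have "transpose A *v sign_modes A u =
      (transpose A ** ((1 / real CARD('n)) *\<^sub>R A)) *v
        (sign_diag (galerkin_D A u) *v (transpose A *v e1))"
    unfolding sign_modes_def haar_H_conjugate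
    by (simp only: matrix_vector_mul_assoc matrix_mul_assoc)
  also have "\<dots> = sign_diag (galerkin_D A u) *v (\<chi> l. 1)"
    by (simp add: haar_type_inverse' haar_type_transpose_e1[OF haar])
  finally show ?thesis
    by (simp add: sign_diag_def diag_mat_vector_mult galerkin_D_eq)
      (simp add: diag_mat_def)
qed

lemma galerkin_P_sign_modes:
  "galerkin_P A (sign_modes A u) =
    haar_H A ** sign_diag (galerkin_D A u) ** transpose (haar_H A)"
  by (simp add: galerkin_P_eq_haar_H transpose_sign_modes sign_diag_def galerkin_D_eq)
    (simp add: diag_mat_def)

text \<open>In the variables \<open>transpose A *v u\<close>, the values of the expansion on the cells, the system decouples.\<close>

lemma sg_flux_eq:
  "sg_flux A u =
    ((1 / real CARD('n)) *\<^sub>R A) *v (\<chi> l. scalar_flux ((transpose A *v u) $ l))"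
proof -
  have "sg_flux A u = galerkin_P A u *v (u + sign_modes A u)"
    by (simp add: sg_flux_def galerkin_prod_def matrix_vector_right_distrib)
  also have "\<dots> = ((1 / real CARD('n)) *\<^sub>R A) *v
      (diag_mat (transpose A *v u) *v (transpose A *v u + transpose A *v sign_modes A u))"
    by (simp only: galerkin_P_conjugate matrix_vector_mul_assoc matrix_vector_right_distrib matrix_mul_assoc)
  also have "diag_mat (transpose A *v u) *v (transpose A *v u + transpose A *v sign_modes A u) =
      (\<chi> l. scalar_flux ((transpose A *v u) $ l))"
    by (simp add: diag_mat_vector_mult transpose_sign_modes scalar_flux_def vec_eq_iff
        power2_eq_square distrib_left abs_sgn)
  finally show ?thesis .
qed

text \<open>The scalar flux of a step function agrees almost everywhere with a step function on the
  same cells, so the projection loses nothing.\<close>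

lemma modes_scalar_flux_expansion: "modes A (\<lambda>\<xi>. scalar_flux (expansion A u \<xi>)) = sg_flux A u"
proof -
  have "scalar_flux \<in> borel_measurable borel"
    unfolding scalar_flux_def[abs_def] by measurable
  then show ?thesis
    by (simp add: modes_composed_expansion sg_flux_eq)
qed

lemma modes_expansion: "modes A (expansion A u) = u"
  using modes_composed_expansion[of "\<lambda>x. x" A u]
  by (simp add: matrix_vector_mul_assoc haar_type_inverse)

text \<open>The three arguments agree as functions, so the predicate can stay a variable, and
  classical and weak solutions are covered at once.\<close>

lemma galerkin_formulation_scalar_flux:
  "galerkin_formulation conservation A scalar_flux initial_u u \<longleftrightarrow>
    conservation u (\<lambda>t x. sg_flux A (u t x))
      (\<lambda>x. \<chi> k. inner_P (\<lambda>\<xi>. initial_u x \<xi>) (haar_basis A k))"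
  by (simp add: galerkin_formulation_def modes_scalar_flux_expansion modes_expansion)
    (simp add: modes_def)

section \<open>Jacobian and generalized Jacobian of the stochastic Galerkin flux\<close>

lemma galerkin_jacobian_eq:
  "2 *\<^sub>R galerkin_P A u + galerkin_P A (sign_modes A u) =
    haar_H A ** (2 *\<^sub>R galerkin_D A u + sign_diag (galerkin_D A u)) ** transpose (haar_H A)"
  unfolding galerkin_P_sign_modes galerkin_P_eq_haar_H[of u] galerkin_D_eq[symmetric]
  by (simp add: matrix_add_ldistrib matrix_add_rdistrib matrix_scalar_ac flip: scalar_matrix_assoc)

lemma two_galerkin_D_add_diag_mat:
  "2 *\<^sub>R galerkin_D A u + diag_mat \<sigma> = diag_mat (2 *\<^sub>R (transpose A *v u) + \<sigma>)"
  by (simp add: galerkin_D_eq diag_mat_def vec_eq_iff)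

lemma generalized_jacobian_sg_flux:
  "generalized_jacobian (sg_flux A) u =
    {haar_H A ** (2 *\<^sub>R galerkin_D A u + diag_mat \<sigma>) ** transpose (haar_H A) | \<sigma>.
       \<forall>l. \<sigma> $ l \<in> generalized_gradient abs (galerkin_D A u $ l $ l)}"
proof -
  define w where "w = transpose A *v u"
  have D: "galerkin_D A u $ l $ l = w $ l" for l
    by (simp add: galerkin_D_eq diag_mat_def w_def)
  define \<Phi> where "\<Phi> a = ((1 / real CARD('n)) *\<^sub>R A) ** diag_mat a ** transpose A" for a
  have "generalized_jacobian (sg_flux A) u =
      {\<Phi> a | a. \<forall>l. a $ l \<in> (+) (2 * w $ l) ` generalized_gradient abs (w $ l)}"
    by (simp add: sg_flux_eq[abs_def] generalized_jacobian_conjugate_componentwise[OF haar_type_inverse]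
        generalized_gradient_scalar_flux w_def \<Phi>_def)
  \<comment> \<open>The substitution \<open>\<sigma> = a - 2 *\<^sub>R w\<close> removes the
    translation that stems from the square.\<close>
  also have "\<dots> = {\<Phi> (2 *\<^sub>R w + \<sigma>) | \<sigma>. \<forall>l. \<sigma> $ l \<in> generalized_gradient abs (w $ l)}"
  proof (intro equalityI subsetI)
    fix J
    assume "J \<in> {\<Phi> a | a. \<forall>l. a $ l \<in> (+) (2 * w $ l) ` generalized_gradient abs (w $ l)}"
    then obtain a where J: "J = \<Phi> a"
      and a: "\<And>l. a $ l \<in> (+) (2 * w $ l) ` generalized_gradient abs (w $ l)"
      by blast
    have "(a - 2 *\<^sub>R w) $ l \<in> generalized_gradient abs (w $ l)" for l
      using a[of l] by auto
    moreover have "J = \<Phi> (2 *\<^sub>R w + (a - 2 *\<^sub>R w))"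
      by (simp add: J)
    ultimately show "J \<in> {\<Phi> (2 *\<^sub>R w + \<sigma>) | \<sigma>. \<forall>l. \<sigma> $ l \<in> generalized_gradient abs (w $ l)}"
      by blast
  next
    fix J
    assume "J \<in> {\<Phi> (2 *\<^sub>R w + \<sigma>) | \<sigma>. \<forall>l. \<sigma> $ l \<in> generalized_gradient abs (w $ l)}"
    then obtain \<sigma> where J: "J = \<Phi> (2 *\<^sub>R w + \<sigma>)"
      and \<sigma>: "\<And>l. \<sigma> $ l \<in> generalized_gradient abs (w $ l)"
      by blast
    have "(2 *\<^sub>R w + \<sigma>) $ l \<in> (+) (2 * w $ l) ` generalized_gradient abs (w $ l)" for l
      using \<sigma>[of l] by simp
    with J show "J \<in> {\<Phi> a | a. \<forall>l. a $ l \<in> (+) (2 * w $ l) ` generalized_gradient abs (w $ l)}"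
      by blast
  qed
  finally show ?thesis
    unfolding haar_H_conjugate two_galerkin_D_add_diag_mat D \<Phi>_def w_def .
qed

lemma galerkin_jacobian_mem_generalized_jacobian:
  "2 *\<^sub>R galerkin_P A u + galerkin_P A (sign_modes A u) \<in> generalized_jacobian (sg_flux A) u"
proof -
  have "(\<chi> i. sgn (galerkin_D A u $ i $ i)) $ l \<in> generalized_gradient abs (galerkin_D A u $ l $ l)" for l
    by (simp add: sgn_in_generalized_gradient_abs)
  then show ?thesis
    unfolding generalized_jacobian_sg_flux galerkin_jacobian_eq sign_diag_def by blast
qed

text \<open>The eigenvalues are the cell values, so none of them meets the kink of the absolute
  value, and the criterion for componentwise maps gives an ordinary derivative.\<close>

lemma sg_flux_has_derivative:
  assumes "\<And>l. galerkin_D A u $ l $ l \<noteq> 0"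
  shows "(sg_flux A has_derivative
    (\<lambda>h. (2 *\<^sub>R galerkin_P A u + galerkin_P A (sign_modes A u)) *v h)) (at u)"
proof -
  define w where "w = transpose A *v u"
  define a where "a = 2 *\<^sub>R w + (\<chi> l. sgn (w $ l))"
  have D: "galerkin_D A u $ l $ l = w $ l" for l
    by (simp add: galerkin_D_eq diag_mat_def w_def)
  have "(scalar_flux has_real_derivative a $ l) (at (w $ l))" for l
    using abs_has_real_derivative_sgn[of "w $ l"] assms[of l]
    by (simp add: scalar_flux_has_derivative_iff a_def D)
  moreover have "2 *\<^sub>R galerkin_P A u + galerkin_P A (sign_modes A u) =
      ((1 / real CARD('n)) *\<^sub>R A) ** diag_mat a ** transpose A"
    by (simp add: galerkin_jacobian_eq sign_diag_def D two_galerkin_D_add_diag_mat haar_H_conjugate a_def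
        flip: w_def)
  ultimately show ?thesis
    unfolding sg_flux_eq[abs_def]
    by (subst has_derivative_conjugate_componentwise_iff[OF haar_type_inverse]) (auto simp: w_def)
qed

end

text \<open>At a vanishing eigenvalue the formula selects \<open>sgn 0 = 0\<close> among many
  generalized derivatives. Its validity at all states is therefore expressed by membership together
  with the full set, and away from such states by an ordinary derivative.\<close>

theorem corollary1:
  fixes A :: "'n::{finite,linorder} rmat"
  assumes "haar_type A"
  shows
    "(\<forall>v. modes A (\<lambda>\<xi>. scalar_flux (expansion A v \<xi>)) = sg_flux A v) \<and>
     (\<forall>conservation \<in> {classical_conservation, weak_conservation}. \<forall>u.
       galerkin_formulation conservation A scalar_flux initial_u u \<longleftrightarrow>
       conservation u (\<lambda>t x. sg_flux A (u t x))
         (\<lambda>x. \<chi> k. inner_P (\<lambda>\<xi>. initial_u x \<xi>) (haar_basis A k))) \<and>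
     (\<forall>v. diagonal_matrix (galerkin_D A v) \<and>
         galerkin_P A v = haar_H A ** galerkin_D A v ** transpose (haar_H A)) \<and>
     (\<forall>v. 2 *\<^sub>R galerkin_P A v + galerkin_P A (sign_modes A v)
         = haar_H A ** (2 *\<^sub>R galerkin_D A v + sign_diag (galerkin_D A v))
             ** transpose (haar_H A)) \<and>
     (\<forall>v. 2 *\<^sub>R galerkin_P A v + galerkin_P A (sign_modes A v)
         \<in> generalized_jacobian (sg_flux A) v) \<and>
     (\<forall>v. generalized_jacobian (sg_flux A) v =
         {haar_H A ** (2 *\<^sub>R galerkin_D A v + diag_mat \<sigma>) ** transpose (haar_H A) | \<sigma>.
            \<forall>l. \<sigma> $ l \<in> generalized_gradient abs (galerkin_D A v $ l $ l)}) \<and>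
     (\<forall>v. (\<forall>l. galerkin_D A v $ l $ l \<noteq> 0) \<longrightarrow>
         (sg_flux A has_derivative
           (\<lambda>h. (2 *\<^sub>R galerkin_P A v + galerkin_P A (sign_modes A v)) *v h)) (at v))"
proof -
  have "diagonal_matrix (galerkin_D A v)" for v
    by (simp add: diagonal_matrix_def diag_mat_def galerkin_D_eq[OF assms])
  moreover have "galerkin_P A v = haar_H A ** galerkin_D A v ** transpose (haar_H A)" for v
    by (simp add: galerkin_P_eq_haar_H[OF assms] galerkin_D_eq[OF assms])
  ultimately show ?thesis
    using sg_flux_has_derivative[OF assms]
    by (intro conjI allI ballI impI modes_scalar_flux_expansion[OF assms]
        galerkin_formulation_scalar_flux[OF assms] galerkin_jacobian_eq[OF assms]
        galerkin_jacobian_mem_generalized_jacobian[OF assms] generalized_jacobian_sg_flux[OF assms])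
      blast+
qed

end
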